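(* Let $m > \ell > 0$ be integers and let $n = 3m - \ell$. Suppose that $\mathcal F \subset 2^{[n]}$ is $3$-partition-free. Then $$\frac{|\mathcal F^{(m - \ell)}|}{\binom{n}{m - \ell}} + \frac{|\mathcal F^{(m)}|}{\binom{n}{m}} + \frac{|\mathcal F^{(m + \ell)}|}{\binom{n}{m + \ell}} \leq 2.$$
   Context: $[n] = \{1,2,\dots,n\}$ and $2^{[n]}$ is its power set. $\binom{[n]}{j}$ denotes the set of all $j$-element subsets of $[n]$. For a family $\mathcal F \subset 2^{[n]}$ and $0 \le j \le n$, $\mathcal F^{(j)} = \mathcal F \cap \binom{[n]}{j}$. For $k \ge 3$, a family $\mathcal F \subset 2^{[n]}$ is called $k$-partition-free if $\mathcal F$ contains no $k$ pairwise disjoint members whose union is $[n]$. *)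

theory Defs
  imports Complex_Main "HOL-Library.Disjoint_Sets" "HOL-Library.Ramsey"
begin

definition level :: "nat \<Rightarrow> nat set set \<Rightarrow> nat \<Rightarrow> nat set set" where
  "level n F j = F \<inter> nsets {1..n} j"

(* The k members are distinct sets, and the empty set is allowed among them. This is why
   partition_on, which excludes the empty set as a block, is not used. *)
definition partition_free :: "nat \<Rightarrow> nat \<Rightarrow> nat set set \<Rightarrow> bool" where
  "partition_free n k F \<longleftrightarrow>
     \<not> (\<exists>P. P \<subseteq> F \<and> finite P \<and> card P = k \<and> disjoint P \<and> \<Union>P = {1..n})"

end

theory Submission
  imports Defs "HOL-Combinatorics.Permutations"
begin

text \<open>
  The sizes \<open>m - l\<close>, \<open>m\<close> and \<open>m + l\<close> admit two kinds of partitions of \<open>{1..n}\<close>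
  into three blocks: one block of size \<open>m - l\<close> with two of size \<open>m\<close>, or two blocks of size \<open>m - l\<close> with one of size
  \<open>m + l\<close>. Averaging the two resulting inequalities separately is too weak: if \<open>a\<close>, \<open>b\<close>, \<open>c\<close> are the
  densities of the three levels, it gives only \<open>a + 2 * b \<le> 2\<close> and \<open>2 * a + c \<le> 2\<close>, which allow
  \<open>a + b + c = 9/4\<close>. The two kinds have to interact inside one configuration.

  Since \<open>n = 3 * (m - l) + 2 * l\<close>, the ground set splits into three cores \<open>A\<close>, \<open>B\<close>, \<open>C\<close> of size
  \<open>m - l\<close> and two extras \<open>D\<close>, \<open>E\<close> of size \<open>l\<close>. Attaching none, one or both of the extras to a core
  yields three sets of size \<open>m - l\<close>, six of size \<open>m\<close> and three of size \<open>m + l\<close>, and any distribution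
  of the two extras over the three cores is a partition of one of the two kinds. The nine partitions
  obtained in this way already force the three proportions of members of \<open>F\<close> among these twelve sets
  to add up to at most 2 (\<open>core_extra_weight\<close>). A uniformly random permutation of the ground set
  carries a fixed \<open>j\<close>-set to a uniformly random one (\<open>permutation_average\<close>), so averaging the
  inequality over all permuted copies of the configuration replaces the proportions by the densities.
\<close>

section \<open>Averaging over permutations\<close>

lemma ex_permutes_image_eq:
  assumes "finite U" "S \<subseteq> U" "T \<subseteq> U" "card S = card T"
  obtains q where "q permutes U" "q ` S = T"
proof -
  have fin: "finite S" "finite T" using assms finite_subset by blast+
  obtain f where f: "bij_betw f S T"
    using fin assms(4) finite_same_card_bij by blast
  have "card (U - S) = card (U - T)"
    using assms fin by (simp add: card_Diff_subset)
  then obtain g where g: "bij_betw g (U - S) (U - T)"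
    using assms(1) finite_same_card_bij by (metis finite_Diff)
  define q where "q x = (if x \<in> S then f x else if x \<in> U then g x else x)" for x
  have qS: "bij_betw q S T"
    using f by (rule bij_betw_cong[THEN iffD1, rotated]) (simp add: q_def)
  have qD: "bij_betw q (U - S) (U - T)"
    using g by (rule bij_betw_cong[THEN iffD1, rotated]) (simp add: q_def)
  have "bij_betw q (S \<union> (U - S)) (T \<union> (U - T))"
    using qS qD by (rule bij_betw_combine) blast
  moreover have "S \<union> (U - S) = U" "T \<union> (U - T) = U" using assms by blast+
  ultimately have "bij_betw q U U" by simp
  then have "q permutes U"
    by (rule bij_imp_permutes) (use assms(2) in \<open>auto simp: q_def\<close>)
  moreover have "q ` S = T" using qS by (simp add: bij_betw_def)
  ultimately show thesis by (rule that)
qed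

text \<open>
  Composing with a permutation that carries \<open>T\<close> to \<open>T'\<close> shows that equally many permutations send
  \<open>S\<close> to \<open>T\<close> and to \<open>T'\<close>. So the image of \<open>S\<close> is equidistributed over the sets of its size, and the
  common count never has to be computed.
\<close>

lemma permutation_average:
  assumes "finite U" "S \<subseteq> U"
  shows "(\<Sum>p | p permutes U. of_bool (p ` S \<in> F)) / fact (card U)
       = real (card (F \<inter> nsets U (card S))) / real (card U choose card S)"
proof -
  define N where "N T = card {p. p permutes U \<and> p ` S = T}" for T
  have finP: "finite {p. p permutes U}" using assms(1) by (rule finite_permutations)
  have finS: "finite S" using assms finite_subset by blast
  have SJ: "S \<in> nsets U (card S)" using assms finS by (simp add: nsets_def)
  have finJ: "finite (nsets U (card S))" using assms(1) by (rule finite_imp_finite_nsets)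
  have image: "p ` S \<in> nsets U (card S)" if "p permutes U" for p
    using that assms finS permutes_image[OF that]
    by (auto simp: nsets_def card_image[OF permutes_inj_on])
  have N_le: "N T \<le> N T'" if T: "T \<in> nsets U (card S)" "T' \<in> nsets U (card S)" for T T'
  proof -
    obtain q where q: "q permutes U" "q ` T = T'"
      using ex_permutes_image_eq[OF assms(1), of T T'] T by (auto simp: nsets_def)
    have "(\<lambda>p. q \<circ> p) ` {p. p permutes U \<and> p ` S = T} \<subseteq> {p. p permutes U \<and> p ` S = T'}"
      using q by (auto simp: image_comp[symmetric] intro: permutes_compose)
    moreover have "inj (\<lambda>p. q \<circ> p)"
      using permutes_inj[OF q(1)] by (auto simp: inj_def fun_eq_iff)
    ultimately show ?thesis
      unfolding N_def using finP by (intro card_inj_on_le) (auto intro: inj_on_subset)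
  qed
  have count: "card {p. p permutes U \<and> p ` S \<in> X} = card X * N S"
    if X: "X \<subseteq> nsets U (card S)" for X
  proof -
    have "{p. p permutes U \<and> p ` S \<in> X} = (\<Union>T\<in>X. {p. p permutes U \<and> p ` S = T})" by blast
    then have "card {p. p permutes U \<and> p ` S \<in> X} = (\<Sum>T\<in>X. N T)"
      unfolding N_def using finP finite_subset[OF X finJ]
      by (simp only:) (intro card_UN_disjoint; auto)
    also have "\<dots> = (\<Sum>T\<in>X. N S)"
      using X SJ N_le by (intro sum.cong refl antisym) blast+
    finally show ?thesis by simp
  qed
  have "{p. p permutes U \<and> p ` S \<in> nsets U (card S)} = {p. p permutes U}"
    using image by blast
  then have total: "fact (card U) = (card U choose card S) * N S"
    using count[OF subset_refl] card_permutations[OF refl assms(1)] by simp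
  have "{p. p permutes U \<and> p ` S \<in> F} = {p. p permutes U \<and> p ` S \<in> F \<inter> nsets U (card S)}"
    using image by blast
  then have "card {p. p permutes U \<and> p ` S \<in> F} = card (F \<inter> nsets U (card S)) * N S"
    using count[of "F \<inter> nsets U (card S)"] by simp
  then have "(\<Sum>p | p permutes U. of_bool (p ` S \<in> F)) = real (card (F \<inter> nsets U (card S)) * N S)"
    using finP by (simp add: Int_def)
  moreover have "(fact (card U) :: real) = real ((card U choose card S) * N S)"
    by (metis total of_nat_fact)
  moreover have "N S \<noteq> 0" using total by (metis fact_nonzero mult_0_right)
  ultimately show ?thesis by simp
qed

section \<open>The core-extra configuration\<close>

lemma partition_free_3D:
  assumes "partition_free n 3 F" "X \<inter> Y = {}" "X \<inter> Z = {}" "Y \<inter> Z = {}"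
    and "X \<noteq> {}" "Y \<noteq> {}" "X \<union> Y \<union> Z = {1..n}"
  shows "\<not> (X \<in> F \<and> Y \<in> F \<and> Z \<in> F)"
proof
  assume "X \<in> F \<and> Y \<in> F \<and> Z \<in> F"
  moreover have "X \<noteq> Y" "X \<noteq> Z" "Y \<noteq> Z" using assms by auto
  moreover from this have "card {X, Y, Z} = 3" by simp
  moreover have "disjoint {X, Y, Z}" using assms by (auto simp: disjoint_def)
  moreover have "\<Union>{X, Y, Z} = {1..n}" using assms(7) by auto
  ultimately have "\<exists>P. P \<subseteq> F \<and> finite P \<and> card P = 3 \<and> disjoint P \<and> \<Union>P = {1..n}"
    by (intro exI[of _ "{X, Y, Z}"]) simp
  with assms(1) show False unfolding partition_free_def by blast
qed

text \<open>
  The coefficients are 6 times the reciprocals of 3, 6 and 3, the numbers of sets with none, one and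
  two extras. If no core is in \<open>F\<close>, the bound is trivial. A single core in \<open>F\<close> makes two disjoint
  pairs of sets with one extra incompatible, so at most four of those six sets are in \<open>F\<close>. A second
  core in \<open>F\<close> is paid for by the loss of the set formed by the third core and both extras. If all
  three cores are in \<open>F\<close>, no set with two extras is, and the six incompatible pairs form a 6-cycle,
  so at most three sets with one extra are.
\<close>

lemma core_extra_weight:
  assumes free: "partition_free n 3 F"
    and disj: "A \<inter> B = {}" "A \<inter> C = {}" "B \<inter> C = {}" "D \<inter> E = {}"
      "(A \<union> B \<union> C) \<inter> (D \<union> E) = {}"
    and ne: "A \<noteq> {}" "B \<noteq> {}" "C \<noteq> {}"
    and union: "A \<union> B \<union> C \<union> D \<union> E = {1..n}"
  shows "2 * (of_bool (A \<in> F) + of_bool (B \<in> F) + of_bool (C \<in> F))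
    + (of_bool (A \<union> D \<in> F) + of_bool (A \<union> E \<in> F) + of_bool (B \<union> D \<in> F)
      + of_bool (B \<union> E \<in> F) + of_bool (C \<union> D \<in> F) + of_bool (C \<union> E \<in> F))
    + 2 * (of_bool (A \<union> D \<union> E \<in> F) + of_bool (B \<union> D \<union> E \<in> F) + of_bool (C \<union> D \<union> E \<in> F))
    \<le> (12 :: real)"
proof -
  define h where "h X = (of_bool (X \<in> F) :: real)" for X
  have h_le: "h X \<le> 1" for X by (simp add: h_def)
  have edge: "h X + h Y + h Z \<le> 2"
    if "X \<inter> Y = {}" "X \<inter> Z = {}" "Y \<inter> Z = {}" "X \<noteq> {}" "Y \<noteq> {}" "X \<union> Y \<union> Z = {1..n}"
    for X Y Z
    using partition_free_3D[OF free that] by (auto simp: h_def)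
  have "X \<inter> Y = {}" "Y \<inter> X = {}" if "X \<in> {A, B, C}" "Y \<in> {D, E}" for X Y
    using that disj(5) by blast+
  then have pairwise: "A \<inter> D = {}" "A \<inter> E = {}" "B \<inter> D = {}" "B \<inter> E = {}"
    "C \<inter> D = {}" "C \<inter> E = {}" "D \<inter> A = {}" "D \<inter> B = {}" "D \<inter> C = {}"
    "E \<inter> A = {}" "E \<inter> B = {}" "E \<inter> C = {}"
    "A \<inter> B = {}" "A \<inter> C = {}" "B \<inter> C = {}" "B \<inter> A = {}" "C \<inter> A = {}" "C \<inter> B = {}"
    "D \<inter> E = {}" "E \<inter> D = {}"
    using disj by (simp_all add: Int_commute)
  have one: "h A + h (B \<union> D) + h (C \<union> E) \<le> 2" "h A + h (B \<union> E) + h (C \<union> D) \<le> 2"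
    "h B + h (A \<union> D) + h (C \<union> E) \<le> 2" "h B + h (A \<union> E) + h (C \<union> D) \<le> 2"
    "h C + h (A \<union> D) + h (B \<union> E) \<le> 2" "h C + h (A \<union> E) + h (B \<union> D) \<le> 2"
    by (rule edge; (simp add: Int_Un_distrib Int_Un_distrib2 pairwise ne; fail |
        subst union[symmetric], blast))+
  have two: "h A + h B + h (C \<union> D \<union> E) \<le> 2" "h A + h C + h (B \<union> D \<union> E) \<le> 2"
    "h B + h C + h (A \<union> D \<union> E) \<le> 2"
    by (rule edge; (simp add: Int_Un_distrib Int_Un_distrib2 pairwise ne; fail |
        subst union[symmetric], blast))+
  note bounds = h_le[of "A \<union> D"] h_le[of "A \<union> E"] h_le[of "B \<union> D"] h_le[of "B \<union> E"]
    h_le[of "C \<union> D"] h_le[of "C \<union> E"]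
    h_le[of "A \<union> D \<union> E"] h_le[of "B \<union> D \<union> E"] h_le[of "C \<union> D \<union> E"]
  have cases01: "h X = 0 \<or> h X = 1" for X by (simp add: h_def)
  (* The linear constraints alone do not imply the bound: 1/2 for the cores, 3/4 for the sets with
     one extra and 1 for those with two satisfy them and have weight 27/2. The bound follows
     linearly once the values of the three cores are fixed to 0 or 1. *)
  have "2 * (h A + h B + h C)
    + (h (A \<union> D) + h (A \<union> E) + h (B \<union> D) + h (B \<union> E) + h (C \<union> D) + h (C \<union> E))
    + 2 * (h (A \<union> D \<union> E) + h (B \<union> D \<union> E) + h (C \<union> D \<union> E)) \<le> 12"
    using cases01[of A] cases01[of B] cases01[of C] one two bounds by smt
  then show ?thesis by (simp only: h_def)
qed

section \<open>The density inequality\<close>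

theorem theorem2:
  fixes m l n :: nat and F :: "nat set set"
  assumes "0 < l" and "l < m"
    and "n = 3 * m - l"
    and "F \<subseteq> Pow {1..n}"
    and "partition_free n 3 F"
  shows "real (card (level n F (m - l))) / real (n choose (m - l))
       + real (card (level n F m)) / real (n choose m)
       + real (card (level n F (m + l))) / real (n choose (m + l)) \<le> 2"
proof -
  define a where "a = m - l"
  have a: "0 < a" "m = a + l" "n = 3 * a + 2 * l" using assms(1-3) by (auto simp: a_def)
  define A B C D E where "A = {1..a}" and "B = {a + 1..2 * a}" and "C = {2 * a + 1..3 * a}"
    and "D = {3 * a + 1..3 * a + l}" and "E = {3 * a + l + 1..3 * a + 2 * l}"
  note blocks = A_def B_def C_def D_def E_def
  have disj: "A \<inter> B = {}" "A \<inter> C = {}" "B \<inter> C = {}" "D \<inter> E = {}"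
    "(A \<union> B \<union> C) \<inter> (D \<union> E) = {}"
    unfolding blocks by auto
  have ne: "A \<noteq> {}" "B \<noteq> {}" "C \<noteq> {}" using a(1) by (auto simp: blocks)
  have union: "A \<union> B \<union> C \<union> D \<union> E = {1..n}"
    unfolding blocks a(3) by auto
  have sub: "A \<subseteq> {1..n}" "B \<subseteq> {1..n}" "C \<subseteq> {1..n}" "D \<subseteq> {1..n}" "E \<subseteq> {1..n}"
    using union by blast+
  have fin: "finite A" "finite B" "finite C" "finite D" "finite E" by (simp_all add: blocks)
  have cards: "card A = a" "card B = a" "card C = a" "card D = l" "card E = l"
    by (simp_all add: blocks)
  have disj': "A \<inter> D = {}" "A \<inter> E = {}" "B \<inter> D = {}" "B \<inter> E = {}" "C \<inter> D = {}" "C \<inter> E = {}"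
    using disj(5) by blast+
  have card1: "card (X \<union> Y) = m" if "X \<in> {A, B, C}" "Y \<in> {D, E}" for X Y
    using that fin cards disj' a(2) by (auto simp: card_Un_disjoint)
  have card2: "card (X \<union> D \<union> E) = m + l" if "X \<in> {A, B, C}" for X
    using that fin cards disj' disj(4) a(2) by (auto simp: card_Un_disjoint Int_Un_distrib2)
  define h where "h S p = (of_bool (p ` S \<in> F) :: real)" for S :: "nat set" and p :: "nat \<Rightarrow> nat"
  let ?P = "{p. p permutes {1..n}}"
  define d where "d j = real (card (level n F j)) / real (n choose j)" for j
  have avg: "(\<Sum>p\<in>?P. h S p) = fact n * d (card S)" if "S \<subseteq> {1..n}" for S
    using permutation_average[OF _ that, of F] by (simp add: h_def d_def level_def field_simps)
  define W where "W p = 2 * (h A p + h B p + h C p)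
    + (h (A \<union> D) p + h (A \<union> E) p + h (B \<union> D) p + h (B \<union> E) p + h (C \<union> D) p + h (C \<union> E) p)
    + 2 * (h (A \<union> D \<union> E) p + h (B \<union> D \<union> E) p + h (C \<union> D \<union> E) p)" for p
  have weight: "W p \<le> 12" if "p \<in> ?P" for p
  proof -
    have p: "p permutes {1..n}" using that by simp
    note inj = image_Int[OF permutes_inj[OF p], symmetric]
    show ?thesis
      unfolding W_def h_def image_Un
      by (rule core_extra_weight[OF assms(5)])
        (simp_all only: inj disj ne union image_Un[symmetric] image_empty image_is_empty
          permutes_image[OF p] not_False_eq_True)
  qed
  have "2 * (fact n * d a + fact n * d a + fact n * d a)
    + (fact n * d m + fact n * d m + fact n * d m + fact n * d m + fact n * d m + fact n * d m)
    + 2 * (fact n * d (m + l) + fact n * d (m + l) + fact n * d (m + l)) \<le> 12 * fact n"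
    using sum_mono[of ?P W "\<lambda>_. 12", OF weight] sub card_permutations[of "{1..n}" n]
    by (simp add: W_def sum.distrib sum_distrib_left[symmetric] avg cards card1 card2 del: One_nat_def)
  then have "fact n * (d a + d m + d (m + l)) \<le> fact n * 2" by (simp add: algebra_simps)
  then have "d a + d m + d (m + l) \<le> 2" by (rule mult_left_le_imp_le) simp
  then show ?thesis by (simp add: d_def a_def)
qed

end
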